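(* For Online Makespan Scheduling under Scenarios with $m=2$ machines and $K=2$ scenarios, there exists a deterministic online algorithm that is $\frac{5}{3}$-competitive.
   Context: Online Makespan Scheduling under Scenarios with parameters $m,K\in\mathbb N$ (known in advance): an instance consists of a number $n$ of jobs, processing times $p_j\ge 0$ for $j\in[n]=\{1,\dots,n\}$, and scenarios $S_1,\dots,S_K\subseteq[n]$. Neither $n$ nor the processing times are known in advance. Jobs are revealed one at a time in the order $1,2,\dots,n$; when job $j$ is revealed, the algorithm learns $p_j$ and the set of $k\in[K]$ with $j\in S_k$ (so it knows $p_1,\dots,p_j$ and $S_k\cap[j]$ for all $k$), and must then irrevocably assign $j$ to a machine $\tau(j)\in[m]$. With $J_i=\tau^{-1}(i)$ and $p(S)=\sum_{j\in S}p_j$, the objective (makespan) is $\max_{k\in[K]}\max_{i\in[m]}p(J_i\cap S_k)$, to be minimized. A deterministic online algorithm is $\rho$-competitive if on every instance its makespan is at most $\rho$ times the minimum makespan over all partitions $J_1\dot\cup\dots\dot\cup J_m=[n]$ (the offline optimum). *)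

theory Defs
  imports Complex_Main "HOL-Library.FuncSet" "HOL-Library.Disjoint_Sets"
begin

text \<open>
  Jobs are \<open>1..n\<close>, machines \<open>1..m\<close>, scenarios \<open>1..K\<close>; \<open>p j\<close> is the processing time of job
  \<open>j\<close> and \<open>S k\<close> is the \<open>k\<close>-th scenario.
\<close>

definition scheduling_instance ::
    "nat \<Rightarrow> nat \<Rightarrow> (nat \<Rightarrow> real) \<Rightarrow> (nat \<Rightarrow> nat set) \<Rightarrow> bool" where
  "scheduling_instance K n p S \<longleftrightarrow>
     (\<forall>j\<in>{1..n}. 0 \<le> p j) \<and> (\<forall>k\<in>{1..K}. S k \<subseteq> {1..n})"

text \<open>Parts may be empty, i.e. machines may be left idle.\<close>

definition job_partition :: "nat \<Rightarrow> nat \<Rightarrow> (nat \<Rightarrow> nat set) \<Rightarrow> bool" where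
  "job_partition m n J \<longleftrightarrow> disjoint_family_on J {1..m} \<and> (\<Union>i\<in>{1..m}. J i) = {1..n}"

text \<open>Meaningful for \<open>m, K \<ge> 1\<close> only, since otherwise a maximum is taken over the empty set.\<close>

definition makespan ::
    "nat \<Rightarrow> nat \<Rightarrow> (nat \<Rightarrow> real) \<Rightarrow> (nat \<Rightarrow> nat set) \<Rightarrow> (nat \<Rightarrow> nat set) \<Rightarrow> real" where
  "makespan m K p S J = (MAX k\<in>{1..K}. MAX i\<in>{1..m}. \<Sum>j\<in>J i \<inter> S k. p j)"

definition opt_makespan ::
    "nat \<Rightarrow> nat \<Rightarrow> nat \<Rightarrow> (nat \<Rightarrow> real) \<Rightarrow> (nat \<Rightarrow> nat set) \<Rightarrow> real" where
  "opt_makespan m K n p S = Min {makespan m K p S J |J. job_partition m n J}"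

text \<open>
  What is revealed with a single job: its processing time and the set of scenarios containing it.
  The history at the arrival of job \<open>j\<close> lists this information for jobs \<open>1..j\<close>. A deterministic
  online algorithm is a function from histories to machines: its earlier decisions are determined
  by prefixes of the history, so they need not be passed to it, and neither \<open>n\<close> nor any
  information on later jobs is available to it.
\<close>

type_synonym job_info = "real \<times> nat set"

definition history ::
    "nat \<Rightarrow> (nat \<Rightarrow> real) \<Rightarrow> (nat \<Rightarrow> nat set) \<Rightarrow> nat \<Rightarrow> job_info list" where
  "history K p S j = map (\<lambda>i. (p i, {k\<in>{1..K}. i \<in> S k})) [1..<Suc j]"

definition online_algorithm :: "nat \<Rightarrow> nat \<Rightarrow> (job_info list \<Rightarrow> nat) \<Rightarrow> bool" where
  "online_algorithm m K A \<longleftrightarrow>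
     (\<forall>h. h \<noteq> [] \<and> (\<forall>(q, T)\<in>set h. 0 \<le> q \<and> T \<subseteq> {1..K}) \<longrightarrow> A h \<in> {1..m})"

definition online_schedule ::
    "nat \<Rightarrow> nat \<Rightarrow> (nat \<Rightarrow> real) \<Rightarrow> (nat \<Rightarrow> nat set) \<Rightarrow> (job_info list \<Rightarrow> nat) \<Rightarrow> nat \<Rightarrow> nat set" where
  "online_schedule K n p S A i = {j\<in>{1..n}. A (history K p S j) = i}"

definition competitive :: "real \<Rightarrow> nat \<Rightarrow> nat \<Rightarrow> (job_info list \<Rightarrow> nat) \<Rightarrow> bool" where
  "competitive \<rho> m K A \<longleftrightarrow>
     (\<forall>n p S. scheduling_instance K n p S \<longrightarrow>
        makespan m K p S (online_schedule K n p S A) \<le> \<rho> * opt_makespan m K n p S)"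

text \<open>
  The minimum defining the offline optimum is attained, and the schedule produced by an online
  algorithm is one of the partitions it ranges over.
\<close>

lemma finite_makespans: "finite {makespan m K p S J |J. job_partition m n J}"
proof (rule finite_subset)
  show "{makespan m K p S J |J. job_partition m n J}
      \<subseteq> makespan m K p S ` ({1..m} \<rightarrow>\<^sub>E Pow {1..n})"
  proof clarify
    fix J assume J: "job_partition m n J"
    have "makespan m K p S J = makespan m K p S (restrict J {1..m})"
      unfolding makespan_def by (intro arg_cong[where f = Max] image_cong refl) auto
    moreover have "restrict J {1..m} \<in> {1..m} \<rightarrow>\<^sub>E Pow {1..n}"
      using J unfolding job_partition_def by (auto simp del: atLeastAtMost_iff)
    ultimately show "makespan m K p S J \<in> makespan m K p S ` ({1..m} \<rightarrow>\<^sub>E Pow {1..n})"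
      by (rule image_eqI)
  qed
  show "finite (makespan m K p S ` ({1..m} \<rightarrow>\<^sub>E Pow {1..n}))"
    by (intro finite_imageI finite_PiE) auto
qed

lemma job_partition_online_schedule:
  assumes "online_algorithm m K A" "scheduling_instance K n p S"
  shows "job_partition m n (online_schedule K n p S A)"
proof -
  have "A (history K p S j) \<in> {1..m}" if "j \<in> {1..n}" for j
  proof -
    have "history K p S j \<noteq> []" using that by (simp add: history_def)
    moreover have "\<forall>(q, T)\<in>set (history K p S j). 0 \<le> q \<and> T \<subseteq> {1..K}"
      using that assms(2) by (auto simp: history_def scheduling_instance_def simp del: upt_Suc)
    ultimately show ?thesis using assms(1) unfolding online_algorithm_def by blast
  qed
  then show ?thesis
    by (auto simp: job_partition_def disjoint_family_on_def online_schedule_def)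
qed

end

theory Submission
  imports Defs
begin

text \<open>
  A state of the online process is described by the four loads \<open>a\<close>, \<open>b\<close> (machines 1 and 2 in
  scenario 1) and \<open>c\<close>, \<open>d\<close> (machines 1 and 2 in scenario 2), by the larger scenario total \<open>t\<close>, and
  by the lower bound \<open>l\<close> on the optimum given by half of \<open>t\<close> and the largest job. The algorithm
  stays inside a set of safe states, described by linear inequalities, from which every job can be
  placed so that the new state is safe again. Besides the goal that all loads are at most
  \<open>5/3 * l\<close>, safety requires three things.

  \<^item> Some machine has load at most \<open>2/3 * t\<close> in both scenarios. This is forced by the threat of a
    job of size \<open>t\<close> belonging to both scenarios.

  \<^item> The cross sums \<open>a + d\<close> and \<open>b + c\<close> are not much larger than \<open>t\<close>. A job in both scenarios
    raises \<open>t\<close> and both cross sums by its size, wherever it is placed. A job in a single scenario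
    raises only one of the cross sums, so the smaller one can be chosen.

  \<^item> A load exceeds the load of the same scenario on the other machine by a lot only if another
    load is comparably large. This covers the case where a job in a single scenario cannot go to
    one machine because of the makespan and not to the other because of the cross sums.
\<close>

definition cross_bounded :: "real \<Rightarrow> real \<Rightarrow> real \<Rightarrow> real \<Rightarrow> bool" where
  "cross_bounded t l x y \<longleftrightarrow> x + y \<le> 7/5 * t \<or> x + y \<le> t + l / 2 \<or>
     (x + y \<le> 17/12 * t \<and> x \<le> 4/5 * t \<and> y \<le> 4/5 * t)"

text \<open>
  Here \<open>x'\<close> is the load of the same scenario on the other machine, \<open>y\<close> that of the other scenario
  on the same machine, and \<open>y'\<close> that of the other scenario on the other machine.
\<close>

definition spread_bounded :: "real \<Rightarrow> real \<Rightarrow> real \<Rightarrow> real \<Rightarrow> real \<Rightarrow> bool" where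
  "spread_bounded l x x' y y' \<longleftrightarrow> x \<le> l + x' \<or> x \<le> l + y' \<or> x \<le> 2/3 * l + y"

definition safe :: "real \<Rightarrow> real \<Rightarrow> real \<Rightarrow> real \<Rightarrow> real \<Rightarrow> real \<Rightarrow> bool" where
  "safe t l a b c d \<longleftrightarrow>
     0 \<le> a \<and> 0 \<le> b \<and> 0 \<le> c \<and> 0 \<le> d \<and> a + b \<le> t \<and> c + d \<le> t \<and> t \<le> 2 * l \<and>
     a \<le> 5/3 * l \<and> b \<le> 5/3 * l \<and> c \<le> 5/3 * l \<and> d \<le> 5/3 * l \<and>
     (a \<le> 2/3 * t \<and> c \<le> 2/3 * t \<or> b \<le> 2/3 * t \<and> d \<le> 2/3 * t) \<and>
     cross_bounded t l a d \<and> cross_bounded t l b c \<and>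
     spread_bounded l a b c d \<and> spread_bounded l b a d c \<and>
     spread_bounded l c d a b \<and> spread_bounded l d c b a"

text \<open>This reduces a job of scenario 2 alone to one of scenario 1 alone.\<close>

lemma safe_swap_scenarios: "safe t l a b c d \<longleftrightarrow> safe t l c d a b"
  unfolding safe_def by (auto simp: cross_bounded_def add.commute)

text \<open>Inequalities on \<open>t'\<close> and \<open>l'\<close> stand in for the maxima of the
  application, so the claim is a Boolean combination of linear inequalities, within reach of
  \<open>argo\<close>.\<close>

lemma safe_job_in_one_scenario:
  assumes "safe t l a b c d" "0 \<le> p" "l \<le> l'" "p \<le> l'" "t' \<le> 2 * l'" "t \<le> t'" "a + b + p \<le> t'"
  shows "safe t' l' (a + p) b c d \<or> safe t' l' a (b + p) c d"
  using assms unfolding safe_def cross_bounded_def spread_bounded_def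
  using [[argo_timeout = 200]] by argo

lemma safe_job_in_both_scenarios:
  assumes "safe t l a b c d" "0 \<le> p" "l \<le> l'" "p \<le> l'" "t + p \<le> 2 * l'"
  shows "safe (t + p) l' (a + p) b (c + p) d \<or> safe (t + p) l' a (b + p) c (d + p)"
  using assms unfolding safe_def cross_bounded_def spread_bounded_def
  using [[argo_timeout = 200]] by argo

text \<open>
  A state consists of the loads, indexed by scenario and then machine, and the largest job so far.
  Jobs outside all scenarios do not affect the optimum and are ignored.
\<close>

type_synonym state = "(nat \<Rightarrow> nat \<Rightarrow> real) \<times> real"

definition place :: "state \<Rightarrow> job_info \<Rightarrow> nat \<Rightarrow> state" where
  "place \<sigma> x i =
     (\<lambda>k i'. fst \<sigma> k i' + (if k \<in> snd x \<and> i' = i then fst x else 0),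
      if snd x = {} then snd \<sigma> else max (snd \<sigma>) (fst x))"

definition max_total :: "(nat \<Rightarrow> nat \<Rightarrow> real) \<Rightarrow> real" where
  "max_total f = max (f 1 1 + f 1 2) (f 2 1 + f 2 2)"

definition safe_state :: "state \<Rightarrow> bool" where
  "safe_state \<sigma> \<longleftrightarrow> (let f = fst \<sigma>; t = max_total f in
     safe t (max (snd \<sigma>) (t / 2)) (f 1 1) (f 1 2) (f 2 1) (f 2 2))"

text \<open>Machine 2 is the untested fallback: from a safe state it is safe whenever machine 1 is
  not.\<close>

definition choose_machine :: "state \<Rightarrow> job_info \<Rightarrow> nat" where
  "choose_machine \<sigma> x = (if safe_state (place \<sigma> x 1) then 1 else 2)"

definition run :: "job_info list \<Rightarrow> state" where
  "run = foldl (\<lambda>\<sigma> x. place \<sigma> x (choose_machine \<sigma> x)) (\<lambda>_ _. 0, 0)"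

definition safe_algorithm :: "job_info list \<Rightarrow> nat" where
  "safe_algorithm h = choose_machine (run (butlast h)) (last h)"

lemma safe_state_choose_machine:
  assumes safe: "safe_state \<sigma>" and q: "0 \<le> q" and T: "T \<subseteq> {1, 2}"
  shows "safe_state (place \<sigma> (q, T) (choose_machine \<sigma> (q, T)))"
proof -
  obtain f P where \<sigma>: "\<sigma> = (f, P)" by (cases \<sigma>)
  define t where "t = max_total f"
  define l where "l = max P (t / 2)"
  have s: "safe t l (f 1 1) (f 1 2) (f 2 1) (f 2 2)"
    using safe by (simp add: safe_state_def \<sigma> t_def l_def Let_def)
  note defs = safe_state_def place_def max_total_def \<sigma> Let_def
  consider "T = {}" | "T = {1}" | "T = {2}" | "T = {1, 2}" using T by blast
  then have "safe_state (place \<sigma> (q, T) 1) \<or> safe_state (place \<sigma> (q, T) 2)"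
  proof cases
    case 1
    then show ?thesis using safe by (simp add: defs)
  next
    case 2
    define t' where "t' = max (f 1 1 + f 1 2 + q) (f 2 1 + f 2 2)"
    have "t \<le> t'" "f 1 1 + f 1 2 + q \<le> t'"
      using q by (auto simp: t_def t'_def max_total_def)
    then have "safe t' (max (max P q) (t' / 2)) (f 1 1 + q) (f 1 2) (f 2 1) (f 2 2) \<or>
        safe t' (max (max P q) (t' / 2)) (f 1 1) (f 1 2 + q) (f 2 1) (f 2 2)"
      using q by (intro safe_job_in_one_scenario[OF s]) (auto simp: l_def)
    then show ?thesis
      using 2 by (simp add: defs t'_def algebra_simps)
  next
    case 3
    define t' where "t' = max (f 1 1 + f 1 2) (f 2 1 + f 2 2 + q)"
    have "t \<le> t'" "f 2 1 + f 2 2 + q \<le> t'"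
      using q by (auto simp: t_def t'_def max_total_def)
    then have "safe t' (max (max P q) (t' / 2)) (f 2 1 + q) (f 2 2) (f 1 1) (f 1 2) \<or>
        safe t' (max (max P q) (t' / 2)) (f 2 1) (f 2 2 + q) (f 1 1) (f 1 2)"
      using q s[THEN safe_swap_scenarios[THEN iffD1]]
      by (intro safe_job_in_one_scenario[of t l]) (auto simp: l_def)
    then show ?thesis
      using 3 by (simp add: defs t'_def algebra_simps safe_swap_scenarios[of _ _ "f 2 _"]
        safe_swap_scenarios[of _ _ "q + f 2 _"])
  next
    case 4
    have "safe (t + q) (max (max P q) ((t + q) / 2)) (f 1 1 + q) (f 1 2) (f 2 1 + q) (f 2 2) \<or>
        safe (t + q) (max (max P q) ((t + q) / 2)) (f 1 1) (f 1 2 + q) (f 2 1) (f 2 2 + q)"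
      using q by (intro safe_job_in_both_scenarios[OF s]) (auto simp: l_def max_def)
    \<comment> \<open>Both totals grow by \<open>q\<close>, hence so does their maximum.\<close>
    moreover have "t + q = max (f 1 1 + f 1 2 + q) (f 2 1 + f 2 2 + q)"
      by (simp add: t_def max_total_def)
    ultimately show ?thesis
      using 4 by (simp add: defs algebra_simps)
  qed
  then show ?thesis by (auto simp: choose_machine_def)
qed

section \<open>The state reached after a history\<close>

lemma history_0: "history K p S 0 = []"
  by (simp add: history_def)

lemma history_Suc:
  "history K p S (Suc j) = history K p S j @ [(p (Suc j), {k\<in>{1..K}. Suc j \<in> S k})]"
  by (simp add: history_def)

lemma run_history_Suc:
  "run (history K p S (Suc j)) =
     place (run (history K p S j)) (p (Suc j), {k\<in>{1..K}. Suc j \<in> S k})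
       (safe_algorithm (history K p S (Suc j)))"
  by (simp add: run_def safe_algorithm_def history_Suc)

lemma safe_state_run:
  assumes "\<And>i. i \<in> {1..j} \<Longrightarrow> 0 \<le> p i"
  shows "safe_state (run (history 2 p S j))"
  using assms
proof (induction j)
  case 0
  show ?case
    by (simp add: history_0 run_def safe_state_def max_total_def safe_def cross_bounded_def
        spread_bounded_def)
next
  case (Suc j)
  then have "safe_state (run (history 2 p S j))" by simp
  moreover have "{k\<in>{1..2}. Suc j \<in> S k} \<subseteq> {1, 2}" by auto
  moreover have "0 \<le> p (Suc j)" using Suc.prems by simp
  ultimately show ?case
    unfolding run_history_Suc unfolding safe_algorithm_def history_Suc butlast_snoc last_snoc
    by (intro safe_state_choose_machine)
qed

text \<open>Earlier decisions depend only on prefixes of the history, so a new job extends the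
  schedule without changing it.\<close>

lemma load_run:
  assumes "k \<in> {1..K}"
  shows "fst (run (history K p S j)) k i = (\<Sum>x\<in>online_schedule K j p S safe_algorithm i \<inter> S k. p x)"
proof (induction j)
  case 0
  show ?case by (simp add: history_0 run_def online_schedule_def)
next
  case (Suc j)
  have fin: "finite (online_schedule K j p S safe_algorithm i)"
    by (simp add: online_schedule_def)
  have nin: "Suc j \<notin> online_schedule K j p S safe_algorithm i"
    by (simp add: online_schedule_def)
  have eq: "online_schedule K (Suc j) p S safe_algorithm i =
      (if safe_algorithm (history K p S (Suc j)) = i
       then insert (Suc j) (online_schedule K j p S safe_algorithm i)
       else online_schedule K j p S safe_algorithm i)"
    by (auto simp: online_schedule_def le_Suc_eq)
  show ?case
    using Suc assms fin nin
    by (simp add: run_history_Suc place_def eq Int_insert_left)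
qed

text \<open>Only jobs in some scenario have to be bounded: \<open>place\<close> leaves the recorded
  maximum alone for all others, which may exceed the optimum.\<close>

lemma largest_job_run_le:
  assumes "\<And>i k. i \<in> {1..j} \<Longrightarrow> k \<in> {1..K} \<Longrightarrow> i \<in> S k \<Longrightarrow> p i \<le> M" and "0 \<le> M"
  shows "snd (run (history K p S j)) \<le> M"
  using assms(1)
proof (induction j)
  case 0
  show ?case using assms(2) by (simp add: history_0 run_def)
next
  case (Suc j)
  then have "snd (run (history K p S j)) \<le> M" by simp
  moreover have "p (Suc j) \<le> M" if "{k\<in>{1..K}. Suc j \<in> S k} \<noteq> {}"
    using that Suc.prems by fastforce
  ultimately show ?case by (simp add: run_history_Suc place_def)
qed

section \<open>Makespan against loads, single jobs and scenario totals\<close>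

lemma load_le_makespan:
  assumes "k \<in> {1..K}" "i \<in> {1..m}"
  shows "(\<Sum>j\<in>J i \<inter> S k. p j) \<le> makespan m K p S J"
proof -
  have "(\<Sum>j\<in>J i \<inter> S k. p j) \<le> (MAX i\<in>{1..m}. \<Sum>j\<in>J i \<inter> S k. p j)"
    using assms(2) by (intro Max_ge) auto
  also have "\<dots> \<le> makespan m K p S J"
    unfolding makespan_def using assms(1) by (intro Max_ge) auto
  finally show ?thesis .
qed

lemma makespan_le:
  assumes "1 \<le> K" "1 \<le> m"
    and "\<And>k i. k \<in> {1..K} \<Longrightarrow> i \<in> {1..m} \<Longrightarrow> (\<Sum>j\<in>J i \<inter> S k. p j) \<le> M"
  shows "makespan m K p S J \<le> M"
  unfolding makespan_def using assms by (subst Max_le_iff, force, force)+ auto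

lemma job_le_makespan:
  assumes "scheduling_instance K n p S" "job_partition m n J"
    and "k \<in> {1..K}" "j \<in> S k"
  shows "p j \<le> makespan m K p S J"
proof -
  have "j \<in> {1..n}" using assms unfolding scheduling_instance_def by blast
  then obtain i where i: "i \<in> {1..m}" "j \<in> J i"
    using assms(2) unfolding job_partition_def by blast
  have sub: "J i \<subseteq> {1..n}" using assms(2) i by (auto simp: job_partition_def)
  then have "finite (J i)" by (rule finite_subset) simp
  then have "p j \<le> (\<Sum>j\<in>J i \<inter> S k. p j)"
    using assms i sub by (intro member_le_sum) (auto simp: scheduling_instance_def)
  also have "\<dots> \<le> makespan m K p S J" using assms(3) i(1) by (rule load_le_makespan)
  finally show ?thesis .
qed

lemma total_eq_sum_loads:
  assumes "scheduling_instance K n p S" "job_partition m n J" "k \<in> {1..K}"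
  shows "(\<Sum>j\<in>S k. p j) = (\<Sum>i\<in>{1..m}. \<Sum>j\<in>J i \<inter> S k. p j)"
proof -
  have "S k \<subseteq> {1..n}" using assms by (simp add: scheduling_instance_def)
  then have "S k = (\<Union>i\<in>{1..m}. J i \<inter> S k)"
    using assms(2) unfolding job_partition_def by blast
  moreover have "(\<Sum>j\<in>(\<Union>i\<in>{1..m}. J i \<inter> S k). p j) = (\<Sum>i\<in>{1..m}. \<Sum>j\<in>J i \<inter> S k. p j)"
    using assms(2) finite_subset[OF \<open>S k \<subseteq> {1..n}\<close>]
    by (intro sum.UNION_disjoint) (auto simp: job_partition_def disjoint_family_on_def)
  ultimately show ?thesis by simp
qed

lemma online_algorithm_safe_algorithm: "online_algorithm 2 2 safe_algorithm"
  by (auto simp: online_algorithm_def safe_algorithm_def choose_machine_def)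

lemma makespan_safe_algorithm_le:
  assumes inst: "scheduling_instance 2 n p S" and J: "job_partition 2 n J"
  shows "makespan 2 2 p S (online_schedule 2 n p S safe_algorithm) \<le> 5/3 * makespan 2 2 p S J"
proof -
  let ?M = "makespan 2 2 p S J" and ?O = "online_schedule 2 n p S safe_algorithm"
  define f where "f = fst (run (history 2 p S n))"
  define P where "P = snd (run (history 2 p S n))"
  define l where "l = max P (max_total f / 2)"
  have two: "{1..2} = {1, 2::nat}" by auto
  have pos: "0 \<le> p j" if "j \<in> {1..n}" for j
    using inst that by (simp add: scheduling_instance_def)
  have f: "f k i = (\<Sum>j\<in>?O i \<inter> S k. p j)" if "k \<in> {1..2}" for k i
    unfolding f_def using that by (rule load_run)
  have O: "job_partition 2 n ?O"
    using online_algorithm_safe_algorithm inst by (rule job_partition_online_schedule)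
  \<comment> \<open>The recorded largest job starts at 0, so bounding it by \<open>?M\<close> needs
    \<open>?M\<close> to be nonnegative.\<close>
  have "J 1 \<subseteq> {1..n}" using J by (auto simp: job_partition_def)
  then have "0 \<le> (\<Sum>j\<in>J 1 \<inter> S 1. p j)"
    using pos by (intro sum_nonneg) auto
  also have "\<dots> \<le> ?M" by (rule load_le_makespan) auto
  finally have "0 \<le> ?M" .
  then have P: "P \<le> ?M"
    unfolding P_def using job_le_makespan[OF inst J] by (intro largest_job_run_le) auto
  \<comment> \<open>A scenario total is the same for every partition, so the online loads can be
    compared with those of \<open>J\<close>.\<close>
  have total: "f k 1 + f k 2 \<le> 2 * ?M" if k: "k \<in> {1..2}" for k
  proof -
    have "f k 1 + f k 2 = (\<Sum>j\<in>S k. p j)"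
      using total_eq_sum_loads[OF inst O k] f[OF k] by (simp only: two) simp
    also have "\<dots> = (\<Sum>j\<in>J 1 \<inter> S k. p j) + (\<Sum>j\<in>J 2 \<inter> S k. p j)"
      using total_eq_sum_loads[OF inst J k] by (simp only: two) simp
    also have "\<dots> \<le> ?M + ?M"
      using k by (intro add_mono load_le_makespan) auto
    finally show ?thesis by simp
  qed
  have l: "l \<le> ?M"
    using P total[of 1] total[of 2] by (simp add: l_def max_total_def)
  have "safe_state (run (history 2 p S n))"
    using pos by (rule safe_state_run)
  then have s: "safe (max_total f) l (f 1 1) (f 1 2) (f 2 1) (f 2 2)"
    by (simp add: safe_state_def Let_def f_def l_def P_def)
  show ?thesis
  proof (rule makespan_le)
    fix k i :: nat assume k: "k \<in> {1..2}" and i: "i \<in> {1..2}"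
    have "f k i \<le> 5/3 * l"
      using s k i unfolding safe_def two by auto
    then show "(\<Sum>j\<in>?O i \<inter> S k. p j) \<le> 5/3 * ?M"
      using f[OF k] l by simp
  qed auto
qed

theorem theorem1:
  shows "\<exists>A. online_algorithm 2 2 A \<and> competitive (5 / 3) 2 2 A"
proof (intro exI conjI)
  show "online_algorithm 2 2 safe_algorithm" by (rule online_algorithm_safe_algorithm)
  show "competitive (5 / 3) 2 2 safe_algorithm"
    unfolding competitive_def
  proof (intro allI impI)
    fix n p S assume inst: "scheduling_instance 2 n p S"
    let ?O = "online_schedule 2 n p S safe_algorithm"
    have "job_partition 2 n ?O"
      using online_algorithm_safe_algorithm inst by (rule job_partition_online_schedule)
    then have "opt_makespan 2 2 n p S \<in> {makespan 2 2 p S J |J. job_partition 2 n J}"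
      unfolding opt_makespan_def by (intro Min_in finite_makespans) blast
    then obtain J where "job_partition 2 n J" "opt_makespan 2 2 n p S = makespan 2 2 p S J"
      by blast
    then show "makespan 2 2 p S ?O \<le> 5 / 3 * opt_makespan 2 2 n p S"
      using makespan_safe_algorithm_le[OF inst] by simp
  qed
qed

end
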